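(* Let $L$ be a flat linear transport over the $n$-dimensional real differentiable manifold $M$. Then there exists a field of bases $\{E_{i'}\}$ in the tangent bundle of $M$ (a basis $\{E_{i'}(x)\}$ of $T_x(M)$ for every $x\in M$) in which the components of the bivector $H(x,y)$ corresponding to $L$ are Kronecker deltas, i.e. $H^{i'}{}_{j'}(x,y)=\delta^{i'}_{j'}$ for all $x,y\in M$. Moreover, if in some field of bases $\{E_i\}$ the components of $H(x,y)$ are constant (with respect to $x$ and $y$), then they are Kronecker deltas and this field of bases can be obtained from $\{E_{i'}\}$ by a linear transformation with constant coefficients (i.e. $E_i(x)=A^{i'}{}_{i}E_{i'}(x)$ with a nondegenerate matrix $[A^{i'}{}_{i}]$ independent of $x$); and conversely, in any field of bases obtained from $\{E_{i'}\}$ by such a transformation the components of $H(x,y)$ are Kronecker deltas.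
   Context: $T^{p,q}_x(M)$ is the space of tensors of type $(p,q)$ at $x$. A flat linear transport (of tensors) over $M$ is a map $L:(x,y)\mapsto L_{x\to y}$, $x,y\in M$, where $L_{x\to y}$ maps tensors at $x$ to tensors at $y$, such that for all $x,y,z\in M$ and all types: (i) $L_{x\to y}(T^{p,q}_x(M))\subseteq T^{p,q}_y(M)$; (ii) $L_{x\to y}$ is linear on each $T^{p,q}_x(M)$; (iii) $L_{x\to y}(A_1\otimes A_2)=(L_{x\to y}A_1)\otimes(L_{x\to y}A_2)$; (iv) $L_{x\to y}\circ C=C\circ L_{x\to y}$ for every contraction operator $C$; (v) $L_{y\to z}\circ L_{x\to y}=L_{x\to z}$; (vi) $L_{x\to x}=\mathrm{id}$. Given a field of bases $\{E_i\}$ with dual bases $\{E^i\}$, the components $H^{i}{}_{j}(y,x)$ are defined by $L_{x\to y}(E_j(x))=H^{i}{}_{j}(y,x)E_i(y)$, and the corresponding bivector is $H(y,x)=H^{i}{}_{j}(y,x)E_i(y)\otimes E^j(x)\in T_y(M)\otimes T_x^*(M)$. Repeated indices are summed. *)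

theory Defs
  imports "HOL-Analysis.Analysis" "HOL-Library.Function_Algebras"
begin

text \<open>Real-valued and vector-valued functions as vectors, with pointwise operations; tangent
  vectors, covectors and tensors below are functions, so that the library notions
  \<^const>\<open>span\<close>, \<^const>\<open>independent\<close>, \<^const>\<open>subspace\<close> apply to them.\<close>

instantiation "fun" :: (type, scaleR) scaleR
begin
definition "scaleR r f = (\<lambda>x. r *\<^sub>R f x)"
instance ..
end

lemma scaleR_fun_apply [simp]: "(r *\<^sub>R f) x = r *\<^sub>R f x"
  by (simp add: scaleR_fun_def)

instance "fun" :: (type, real_vector) real_vector
  by standard (auto simp: fun_eq_iff scaleR_add_right scaleR_add_left)

lemma sum_fun_apply: "(\<Sum>i\<in>I. f i) x = (\<Sum>i\<in>I. f i x)"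
  by (induction I rule: infinite_finite_induct) auto


section \<open>Differentiable manifolds\<close>

text \<open>A chart is a pair \<open>(U, \<phi>)\<close>; the values of \<open>\<phi>\<close> outside \<open>U\<close> are irrelevant.\<close>

type_synonym ('m, 'n) chart = "'m set \<times> ('m \<Rightarrow> real ^ 'n)"

definition is_chart :: "'m topology \<Rightarrow> ('m, 'n::finite) chart \<Rightarrow> bool" where
  "is_chart M c \<longleftrightarrow> openin M (fst c) \<and> open (snd c ` fst c) \<and>
     homeomorphic_map (subtopology M (fst c)) (top_of_set (snd c ` fst c)) (snd c)"

text \<open>The change of coordinates \<open>\<psi> \<circ> \<phi>\<inverse>\<close> from \<open>c = (U, \<phi>)\<close> to \<open>d = (V, \<psi>)\<close>, to be used on
  \<open>\<phi> ` (U \<inter> V)\<close> only.\<close>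

definition transition :: "('m, 'n::finite) chart \<Rightarrow> ('m, 'n) chart \<Rightarrow> real ^ 'n \<Rightarrow> real ^ 'n" where
  "transition c d = snd d \<circ> inv_into (fst c) (snd c)"

definition C1_on :: "(real ^ 'n::finite) set \<Rightarrow> (real ^ 'n \<Rightarrow> real ^ 'n) \<Rightarrow> bool" where
  "C1_on S f \<longleftrightarrow> (\<forall>p\<in>S. f differentiable at p) \<and>
     (\<forall>v. continuous_on S (\<lambda>p. frechet_derivative f (at p) v))"

text \<open>An \<open>n\<close>-dimensional real differentiable manifold with \<open>n = CARD('n)\<close>. Differentiability is
  required in the weakest sense (class \<open>C\<^sup>1\<close>), so that smooth manifolds are included; likewise
  second countability and connectedness are not imposed. The atlas need not be maximal.\<close>

definition differentiable_manifold :: "'m topology \<Rightarrow> ('m, 'n::finite) chart set \<Rightarrow> bool" where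
  "differentiable_manifold M \<A> \<longleftrightarrow>
     Hausdorff_space M \<and>
     (\<forall>c\<in>\<A>. is_chart M c) \<and>
     (\<Union>c\<in>\<A>. fst c) = topspace M \<and>
     (\<forall>c\<in>\<A>. \<forall>d\<in>\<A>. C1_on (snd c ` (fst c \<inter> fst d)) (transition c d))"


section \<open>Tangent vectors and covectors\<close>

text \<open>A tangent vector at \<open>x\<close> is given by its coordinate vectors in all charts around \<open>x\<close>, related by
  the Jacobians of the coordinate changes. The values at all other charts are set to \<open>0\<close>. The base
  point is not recorded in the vector.\<close>

type_synonym ('m, 'n) tvec = "('m, 'n) chart \<Rightarrow> real ^ 'n"
type_synonym ('m, 'n) covec = "('m, 'n) tvec \<Rightarrow> real"

definition charts_at :: "('m, 'n::finite) chart set \<Rightarrow> 'm \<Rightarrow> ('m, 'n) chart set" where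
  "charts_at \<A> x = {c \<in> \<A>. x \<in> fst c}"

definition tangent_space :: "('m, 'n::finite) chart set \<Rightarrow> 'm \<Rightarrow> ('m, 'n) tvec set" where
  "tangent_space \<A> x =
     {v. (\<forall>c. c \<notin> charts_at \<A> x \<longrightarrow> v c = 0) \<and>
         (\<forall>c\<in>charts_at \<A> x. \<forall>d\<in>charts_at \<A> x.
            v d = frechet_derivative (transition c d) (at (snd c x)) (v c))}"

text \<open>Covectors are linear functionals on the tangent space, extended by \<open>0\<close> outside of it.\<close>

definition cotangent_space :: "('m, 'n::finite) chart set \<Rightarrow> 'm \<Rightarrow> ('m, 'n) covec set" where
  "cotangent_space \<A> x =
     {\<omega>. (\<forall>v. v \<notin> tangent_space \<A> x \<longrightarrow> \<omega> v = 0) \<and>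
         (\<forall>u\<in>tangent_space \<A> x. \<forall>v\<in>tangent_space \<A> x. \<omega> (u + v) = \<omega> u + \<omega> v) \<and>
         (\<forall>a. \<forall>v\<in>tangent_space \<A> x. \<omega> (a *\<^sub>R v) = a * \<omega> v)}"

definition basis_of :: "('n::finite \<Rightarrow> 'v::real_vector) \<Rightarrow> 'v set \<Rightarrow> bool" where
  "basis_of e V \<longleftrightarrow> inj e \<and> independent (range e) \<and> span (range e) = V"

text \<open>The dual basis: \<open>E\<^sup>i\<close> maps a tangent vector to its \<open>i\<close>-th coefficient in the basis \<open>e\<close>
  (and vectors outside the span of \<open>e\<close> to \<open>0\<close>).\<close>

definition dual_basis :: "('n::finite \<Rightarrow> ('m, 'n) tvec) \<Rightarrow> 'n \<Rightarrow> ('m, 'n) covec" where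
  "dual_basis e i = (\<lambda>v. representation (range e) v (e i))"


section \<open>Tensors\<close>

text \<open>A tensor of type \<open>(p, q)\<close> at \<open>x\<close> is a multilinear form in \<open>p\<close> covectors and \<open>q\<close> vectors at \<open>x\<close>,
  extended by \<open>0\<close> to all other pairs of lists.\<close>

type_synonym ('m, 'n) tensor = "('m, 'n) covec list \<Rightarrow> ('m, 'n) tvec list \<Rightarrow> real"

definition tensor_args ::
  "('m, 'n::finite) chart set \<Rightarrow> 'm \<Rightarrow> nat \<Rightarrow> nat \<Rightarrow> (('m, 'n) covec list \<times> ('m, 'n) tvec list) set"
where
  "tensor_args \<A> x p q =
     {(\<omega>s, vs). length \<omega>s = p \<and> set \<omega>s \<subseteq> cotangent_space \<A> x \<and>
                length vs = q \<and> set vs \<subseteq> tangent_space \<A> x}"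

definition tensor_space ::
  "('m, 'n::finite) chart set \<Rightarrow> 'm \<Rightarrow> nat \<Rightarrow> nat \<Rightarrow> ('m, 'n) tensor set" where
  "tensor_space \<A> x p q =
     {t. (\<forall>\<omega>s vs. (\<omega>s, vs) \<notin> tensor_args \<A> x p q \<longrightarrow> t \<omega>s vs = 0) \<and>
         (\<forall>(\<omega>s, vs) \<in> tensor_args \<A> x p q.
            (\<forall>k<p. \<forall>\<alpha>\<in>cotangent_space \<A> x. \<forall>\<beta>\<in>cotangent_space \<A> x. \<forall>a b.
               t (\<omega>s[k := a *\<^sub>R \<alpha> + b *\<^sub>R \<beta>]) vs = a * t (\<omega>s[k := \<alpha>]) vs + b * t (\<omega>s[k := \<beta>]) vs) \<and>
            (\<forall>l<q. \<forall>u\<in>tangent_space \<A> x. \<forall>v\<in>tangent_space \<A> x. \<forall>a b.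
               t \<omega>s (vs[l := a *\<^sub>R u + b *\<^sub>R v]) = a * t \<omega>s (vs[l := u]) + b * t \<omega>s (vs[l := v])))}"

text \<open>The tensor product of a tensor \<open>s\<close> of type \<open>(p, q)\<close> with a tensor \<open>t\<close> of arbitrary type; the
  arguments of \<open>s\<close> come first.\<close>

definition tensor_prod ::
  "nat \<Rightarrow> nat \<Rightarrow> ('m, 'n) tensor \<Rightarrow> ('m, 'n) tensor \<Rightarrow> ('m, 'n) tensor" where
  "tensor_prod p q s t = (\<lambda>\<omega>s vs. s (take p \<omega>s) (take q vs) * t (drop p \<omega>s) (drop q vs))"

definition insert_at :: "nat \<Rightarrow> 'a \<Rightarrow> 'a list \<Rightarrow> 'a list" where
  "insert_at k a xs = take k xs @ a # drop k xs"

text \<open>Contraction of the \<open>k\<close>-th covector slot with the \<open>l\<close>-th vector slot (counted from \<open>0\<close>),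
  computed with an arbitrary basis; independence of the basis is shown in
  \<open>contraction_any_basis\<close>.\<close>

definition contraction_in ::
  "('n::finite \<Rightarrow> ('m, 'n) tvec) \<Rightarrow> nat \<Rightarrow> nat \<Rightarrow> ('m, 'n) tensor \<Rightarrow> ('m, 'n) tensor" where
  "contraction_in e k l t =
     (\<lambda>\<omega>s vs. \<Sum>i\<in>UNIV. t (insert_at k (dual_basis e i) \<omega>s) (insert_at l (e i) vs))"

definition contraction ::
  "('m, 'n::finite) chart set \<Rightarrow> 'm \<Rightarrow> nat \<Rightarrow> nat \<Rightarrow> ('m, 'n) tensor \<Rightarrow> ('m, 'n) tensor" where
  "contraction \<A> x k l = contraction_in (SOME e. basis_of e (tangent_space \<A> x)) k l"

text \<open>A tangent vector as a tensor of type \<open>(1, 0)\<close>.\<close>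

definition vec_tensor :: "('m, 'n::finite) chart set \<Rightarrow> 'm \<Rightarrow> ('m, 'n) tvec \<Rightarrow> ('m, 'n) tensor" where
  "vec_tensor \<A> x v =
     (\<lambda>\<omega>s vs. if (\<omega>s, vs) \<in> tensor_args \<A> x 1 0 then hd \<omega>s v else 0)"


section \<open>Flat linear transports\<close>

text \<open>\<open>L x y\<close> is the transport from \<open>x\<close> to \<open>y\<close>. Since a nonzero tensor determines its type,
  a single map covers all types; its values outside the tensor spaces at \<open>x\<close> are irrelevant.\<close>

definition flat_linear_transport ::
  "'m topology \<Rightarrow> ('m, 'n::finite) chart set \<Rightarrow>
     ('m \<Rightarrow> 'm \<Rightarrow> ('m, 'n) tensor \<Rightarrow> ('m, 'n) tensor) \<Rightarrow> bool" where
  "flat_linear_transport M \<A> L \<longleftrightarrow>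
     (\<forall>x\<in>topspace M. \<forall>y\<in>topspace M.
        (\<forall>p q. L x y ` tensor_space \<A> x p q \<subseteq> tensor_space \<A> y p q) \<and>
        (\<forall>p q. \<forall>s\<in>tensor_space \<A> x p q. \<forall>t\<in>tensor_space \<A> x p q. \<forall>a b.
           L x y (a *\<^sub>R s + b *\<^sub>R t) = a *\<^sub>R L x y s + b *\<^sub>R L x y t) \<and>
        (\<forall>p q p' q'. \<forall>s\<in>tensor_space \<A> x p q. \<forall>t\<in>tensor_space \<A> x p' q'.
           L x y (tensor_prod p q s t) = tensor_prod p q (L x y s) (L x y t)) \<and>
        (\<forall>p q k l. \<forall>t\<in>tensor_space \<A> x p q. k < p \<longrightarrow> l < q \<longrightarrow>
           L x y (contraction \<A> x k l t) = contraction \<A> y k l (L x y t)) \<and>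
        (\<forall>z\<in>topspace M. \<forall>p q. \<forall>t\<in>tensor_space \<A> x p q. L y z (L x y t) = L x z t)) \<and>
     (\<forall>x\<in>topspace M. \<forall>p q. \<forall>t\<in>tensor_space \<A> x p q. L x x t = t)"

text \<open>Fields of bases are not required to depend continuously on the point.\<close>

definition field_of_bases ::
  "'m topology \<Rightarrow> ('m, 'n::finite) chart set \<Rightarrow> ('m \<Rightarrow> 'n \<Rightarrow> ('m, 'n) tvec) \<Rightarrow> bool" where
  "field_of_bases M \<A> E \<longleftrightarrow> (\<forall>x\<in>topspace M. basis_of (E x) (tangent_space \<A> x))"

text \<open>The matrix of components \<open>H\<^sup>i\<^sub>j(y,x)\<close> (row \<open>i\<close>, column \<open>j\<close>), determined by
  \<open>L\<^bsub>x\<rightarrow>y\<^esub> (E\<^sub>j(x)) = H\<^sup>i\<^sub>j(y,x) E\<^sub>i(y)\<close>. Note the order of the points.\<close>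

definition transport_components ::
  "('m, 'n::finite) chart set \<Rightarrow> ('m \<Rightarrow> 'm \<Rightarrow> ('m, 'n) tensor \<Rightarrow> ('m, 'n) tensor) \<Rightarrow>
     ('m \<Rightarrow> 'n \<Rightarrow> ('m, 'n) tvec) \<Rightarrow> 'm \<Rightarrow> 'm \<Rightarrow> real ^ 'n ^ 'n" where
  "transport_components \<A> L E y x =
     (THE h. \<forall>j. L x y (vec_tensor \<A> x (E x j)) =
        (\<Sum>i\<in>UNIV. (h $ i $ j) *\<^sub>R vec_tensor \<A> y (E y i)))"

text \<open>The corresponding bivector \<open>H(y,x) = H\<^sup>i\<^sub>j(y,x) E\<^sub>i(y) \<otimes> E\<^sup>j(x)\<close>, as a bilinear form in a
  covector at \<open>y\<close> and a vector at \<open>x\<close>. By \<open>transport_bivector_eq\<close> it does not depend on \<open>E\<close>, and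
  its components in \<open>E\<close> are \<^const>\<open>transport_components\<close>.\<close>

definition transport_bivector ::
  "('m, 'n::finite) chart set \<Rightarrow> ('m \<Rightarrow> 'm \<Rightarrow> ('m, 'n) tensor \<Rightarrow> ('m, 'n) tensor) \<Rightarrow>
     ('m \<Rightarrow> 'n \<Rightarrow> ('m, 'n) tvec) \<Rightarrow> 'm \<Rightarrow> 'm \<Rightarrow> ('m, 'n) covec \<Rightarrow> ('m, 'n) tvec \<Rightarrow> real" where
  "transport_bivector \<A> L E y x = (\<lambda>\<omega> v. \<Sum>i\<in>UNIV. \<Sum>j\<in>UNIV.
     transport_components \<A> L E y x $ i $ j * (\<omega> (E y i) * dual_basis (E x) j v))"


section \<open>Well-definedness\<close>

text \<open>The tangent spaces have dimension \<open>n\<close>.\<close>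

lemma open_chart_overlap:
  assumes "is_chart M c" "is_chart M d"
  shows "open (snd c ` (fst c \<inter> fst d))"
proof -
  have "openin (subtopology M (fst c)) (fst c \<inter> fst d)"
    using assms unfolding is_chart_def by (metis inf_commute openin_subtopology_Int)
  moreover have "fst c \<subseteq> topspace M"
    using assms(1) openin_subset unfolding is_chart_def by blast
  ultimately have "openin (top_of_set (snd c ` fst c)) (snd c ` (fst c \<inter> fst d))"
    using assms(1) homeomorphic_map_openness[of "subtopology M (fst c)"]
    unfolding is_chart_def by (metis Int_lower1 inf.absorb2 topspace_subtopology)
  then show ?thesis
    using assms(1) openin_open_trans unfolding is_chart_def by blast
qed

lemma inj_on_chart:
  assumes "is_chart M c"
  shows "inj_on (snd c) (fst c)"
proof -
  have "fst c \<subseteq> topspace M"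
    using assms openin_subset unfolding is_chart_def by blast
  then show ?thesis
    using assms homeomorphic_imp_injective_map unfolding is_chart_def
    by (metis inf.absorb2 topspace_subtopology)
qed

lemma transition_apply:
  assumes "is_chart M c" "m \<in> fst c"
  shows "transition c d (snd c m) = snd d m"
  using assms inj_on_chart[OF assms(1)] by (simp add: transition_def inv_into_f_f)

lemma transition_has_derivative:
  assumes "differentiable_manifold M \<A>" "c \<in> charts_at \<A> x" "d \<in> charts_at \<A> x"
  shows "(transition c d has_derivative frechet_derivative (transition c d) (at (snd c x))) (at (snd c x))"
  using assms unfolding differentiable_manifold_def charts_at_def C1_on_def frechet_derivative_works
  by blast

lemma transition_cocycle:
  assumes "differentiable_manifold M \<A>"
    and "c \<in> charts_at \<A> x" "d \<in> charts_at \<A> x" "e \<in> charts_at \<A> x"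
  shows "frechet_derivative (transition d e) (at (snd d x)) (frechet_derivative (transition c d) (at (snd c x)) w)
       = frechet_derivative (transition c e) (at (snd c x)) w"
proof -
  have ch: "is_chart M c" "is_chart M d" "x \<in> fst c" "x \<in> fst d"
    using assms unfolding differentiable_manifold_def charts_at_def by auto
  let ?S = "snd c ` (fst c \<inter> fst d)"
  have x: "transition c d (snd c x) = snd d x"
    by (rule transition_apply[OF ch(1,3)])
  have comp: "((transition d e \<circ> transition c d) has_derivative
     (frechet_derivative (transition d e) (at (snd d x)) \<circ> frechet_derivative (transition c d) (at (snd c x)))) (at (snd c x))"
    by (rule diff_chain_at[OF transition_has_derivative[OF assms(1,2,3)]])
       (unfold x, rule transition_has_derivative[OF assms(1,3,4)])
  have "(transition c e has_derivative
     (frechet_derivative (transition d e) (at (snd d x)) \<circ> frechet_derivative (transition c d) (at (snd c x)))) (at (snd c x))"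
  proof (rule has_derivative_transform_within_open[OF comp, of ?S])
    show "open ?S" using open_chart_overlap ch by blast
    show "snd c x \<in> ?S" using ch by blast
    show "(transition d e \<circ> transition c d) p = transition c e p" if "p \<in> ?S" for p
      using that transition_apply[OF ch(1), of _ d] transition_apply[OF ch(1), of _ e]
        transition_apply[OF ch(2), of _ e] by auto
  qed
  from frechet_derivative_at[OF this, symmetric] show ?thesis
    by simp
qed

lemma transition_self:
  assumes "differentiable_manifold M \<A>" "c \<in> charts_at \<A> x"
  shows "frechet_derivative (transition c c) (at (snd c x)) w = w"
proof -
  have ch: "is_chart M c" "x \<in> fst c"
    using assms unfolding differentiable_manifold_def charts_at_def by auto
  have "(transition c c has_derivative id) (at (snd c x))"
  proof (rule has_derivative_transform_within_open[OF has_derivative_id, of "snd c ` fst c"])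
    show "open (snd c ` fst c)" using ch unfolding is_chart_def by blast
    show "snd c x \<in> snd c ` fst c" using ch by blast
    show "id p = transition c c p" if "p \<in> snd c ` fst c" for p
      using that transition_apply[OF ch(1), of _ c] by auto
  qed
  from frechet_derivative_at[OF this, symmetric] show ?thesis
    by simp
qed

lemma tangent_space_basis_exists:
  fixes \<A> :: "('m, 'n::finite) chart set"
  assumes "differentiable_manifold M \<A>" "x \<in> topspace M"
  shows "\<exists>e :: 'n \<Rightarrow> ('m, 'n) tvec. basis_of e (tangent_space \<A> x)"
proof -
  obtain c where c: "c \<in> charts_at \<A> x"
    using assms unfolding differentiable_manifold_def charts_at_def by blast
  define G where "G w = (\<lambda>d. if d \<in> charts_at \<A> x
      then frechet_derivative (transition c d) (at (snd c x)) w else 0)" for w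
  have lin_d: "linear (frechet_derivative (transition c d) (at (snd c x)))"
    if "d \<in> charts_at \<A> x" for d
    using transition_has_derivative[OF assms(1) c that] has_derivative_linear by blast
  have lin: "linear G"
    by (rule linearI) (auto simp: G_def fun_eq_iff linear_add[OF lin_d] linear_scale[OF lin_d])
  have Gc: "G w c = w" for w
    using c transition_self[OF assms(1) c] by (simp add: G_def)
  have inj: "inj G"
    using Gc by (metis injI)
  have "range G = tangent_space \<A> x"
  proof
    show "range G \<subseteq> tangent_space \<A> x"
      using transition_cocycle[OF assms(1) c] unfolding G_def tangent_space_def by auto
    show "tangent_space \<A> x \<subseteq> range G"
    proof
      fix v assume "v \<in> tangent_space \<A> x"
      then have "v = G (v c)"
        using c unfolding G_def tangent_space_def by (intro ext) (simp (no_asm_simp), blast)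
      then show "v \<in> range G" by blast
    qed
  qed
  moreover have "range (\<lambda>i. G (axis i 1)) = G ` Basis"
    by (auto simp: Basis_vec_def)
  moreover have "independent (G ` Basis)"
    using linear_independent_injective_image[OF lin independent_Basis] inj
    by (simp add: inj_on_def)
  moreover have "span (G ` Basis) = range G"
    using linear_span_image[OF lin, of Basis] by simp
  moreover have "inj (\<lambda>i. G (axis i (1::real)))"
    by (rule injI) (use inj in \<open>simp add: inj_eq axis_eq_axis\<close>)
  ultimately show ?thesis
    unfolding basis_of_def by (intro exI[of _ "\<lambda>i. G (axis i 1)"]) simp
qed

lemma basis_of_expansion:
  fixes e :: "'n::finite \<Rightarrow> ('m, 'n) tvec"
  assumes "basis_of e V" "v \<in> V"
  shows "v = (\<Sum>i\<in>UNIV. dual_basis e i v *\<^sub>R e i)"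
proof -
  have "(\<Sum>b\<in>range e. representation (range e) v b *\<^sub>R b) = v"
    using assms unfolding basis_of_def by (intro sum_representation_eq) auto
  then show ?thesis
    using assms(1) unfolding basis_of_def dual_basis_def by (simp add: sum.reindex)
qed

lemma dual_basis_basis:
  assumes "basis_of e V"
  shows "dual_basis e i (e j) = (if i = j then 1 else 0)"
  using assms representation_basis[of "range e" "e j"] unfolding basis_of_def dual_basis_def
  by (auto simp: inj_def)

lemma dual_basis_cotangent:
  assumes "basis_of e (tangent_space \<A> x)"
  shows "dual_basis e i \<in> cotangent_space \<A> x"
proof -
  have ind: "independent (range e)" and T: "tangent_space \<A> x = span (range e)"
    using assms unfolding basis_of_def by auto
  have "representation (range e) v b = 0" if "v \<notin> span (range e)" for v b
    using that by (simp add: representation_def)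
  then show ?thesis
    unfolding cotangent_space_def dual_basis_def T
    by (simp add: representation_add[OF ind] representation_scale[OF ind])
qed

lemma basis_of_mem: "basis_of e V \<Longrightarrow> e i \<in> V"
  unfolding basis_of_def by (metis rangeI span_base)

lemma basis_of_subspace: "basis_of e V \<Longrightarrow> subspace V"
  unfolding basis_of_def by (metis subspace_span)

lemma subspace_cotangent: "subspace (cotangent_space \<A> x)"
  unfolding subspace_def cotangent_space_def
  by (simp add: distrib_left add_ac mult.left_commute)

lemma sum_of_linear_on:
  fixes g :: "'v::real_vector \<Rightarrow> real"
  assumes S: "subspace S" and "finite I" and v: "\<And>i. i \<in> I \<Longrightarrow> v i \<in> S"
    and g: "\<And>u w a b. u \<in> S \<Longrightarrow> w \<in> S \<Longrightarrow> g (a *\<^sub>R u + b *\<^sub>R w) = a * g u + b * g w"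
  shows "g (\<Sum>i\<in>I. a i *\<^sub>R v i) = (\<Sum>i\<in>I. a i * g (v i))"
  using assms(2) v
proof (induction I)
  case empty
  then show ?case using g[of 0 0 0 0] subspace_0[OF S] by simp
next
  case (insert i I)
  have "(\<Sum>i\<in>I. a i *\<^sub>R v i) \<in> S"
    using insert.prems by (intro subspace_sum[OF S] subspace_scale[OF S]) simp
  then show ?case
    using insert g[of "v i" "\<Sum>i\<in>I. a i *\<^sub>R v i" "a i" 1] by simp
qed

lemma cotangent_lincomb:
  assumes "\<omega> \<in> cotangent_space \<A> x" "subspace (tangent_space \<A> x)"
    and "u \<in> tangent_space \<A> x" "v \<in> tangent_space \<A> x"
  shows "\<omega> (a *\<^sub>R u + b *\<^sub>R v) = a * \<omega> u + b * \<omega> v"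
  using assms(1) assms(3,4)[THEN subspace_scale[OF assms(2)]] assms(3,4)
  unfolding cotangent_space_def by simp

lemma cotangent_expansion:
  assumes e: "basis_of e (tangent_space \<A> x)" and "\<omega> \<in> cotangent_space \<A> x"
  shows "\<omega> = (\<Sum>i\<in>UNIV. \<omega> (e i) *\<^sub>R dual_basis e i)"
proof
  fix v
  show "\<omega> v = (\<Sum>i\<in>UNIV. \<omega> (e i) *\<^sub>R dual_basis e i) v"
  proof (cases "v \<in> tangent_space \<A> x")
    case True
    have "\<omega> v = \<omega> (\<Sum>i\<in>UNIV. dual_basis e i v *\<^sub>R e i)"
      using basis_of_expansion[OF e True] by simp
    also have "\<dots> = (\<Sum>i\<in>UNIV. dual_basis e i v * \<omega> (e i))"
      by (rule sum_of_linear_on[where g = \<omega>, OF basis_of_subspace[OF e]])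
         (auto intro: basis_of_mem[OF e] cotangent_lincomb[OF assms(2) basis_of_subspace[OF e]])
    finally show ?thesis
      by (simp add: sum_fun_apply mult.commute)
  next
    case False
    then show ?thesis
      using assms(2) dual_basis_cotangent[OF e] unfolding cotangent_space_def
      by (simp add: sum_fun_apply)
  qed
qed

text \<open>Contractions do not depend on the basis.\<close>

lemma insert_at_update:
  "k \<le> length xs \<Longrightarrow> insert_at k a xs = (insert_at k b xs)[k := a]"
  by (simp add: insert_at_def list_update_append)

lemma insert_at_list:
  "set (insert_at k a xs) = insert a (set xs)" "length (insert_at k a xs) = Suc (length xs)"
proof -
  have "set (take k xs) \<union> set (drop k xs) = set xs"
    by (metis append_take_drop_id set_append)
  then show "set (insert_at k a xs) = insert a (set xs)"
    unfolding insert_at_def by auto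
qed (simp add: insert_at_def)

lemma tensor_args_insert:
  assumes "k < p" "l < q" "\<omega> \<in> cotangent_space \<A> x" "v \<in> tangent_space \<A> x"
  shows "(insert_at k \<omega> \<omega>s, insert_at l v vs) \<in> tensor_args \<A> x p q \<longleftrightarrow>
         (\<omega>s, vs) \<in> tensor_args \<A> x (p - 1) (q - 1)"
  using assms unfolding tensor_args_def by (auto simp: insert_at_list)

lemma tensor_slot_linear:
  assumes t: "t \<in> tensor_space \<A> x p q" and kl: "k < p" "l < q"
    and args: "(\<omega>s, vs) \<in> tensor_args \<A> x (p - 1) (q - 1)"
    and T: "subspace (tangent_space \<A> x)"
  shows "\<lbrakk>\<alpha> \<in> cotangent_space \<A> x; \<beta> \<in> cotangent_space \<A> x; v \<in> tangent_space \<A> x\<rbrakk> \<Longrightarrow>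
      t (insert_at k (a *\<^sub>R \<alpha> + b *\<^sub>R \<beta>) \<omega>s) (insert_at l v vs) =
      a * t (insert_at k \<alpha> \<omega>s) (insert_at l v vs) + b * t (insert_at k \<beta> \<omega>s) (insert_at l v vs)"
    and "\<lbrakk>u \<in> tangent_space \<A> x; v \<in> tangent_space \<A> x; \<alpha> \<in> cotangent_space \<A> x\<rbrakk> \<Longrightarrow>
      t (insert_at k \<alpha> \<omega>s) (insert_at l (a *\<^sub>R u + b *\<^sub>R v) vs) =
      a * t (insert_at k \<alpha> \<omega>s) (insert_at l u vs) + b * t (insert_at k \<alpha> \<omega>s) (insert_at l v vs)"
proof -
  have len: "k \<le> length \<omega>s" "l \<le> length vs"
    using args kl unfolding tensor_args_def by auto
  {
    assume *: "\<alpha> \<in> cotangent_space \<A> x" "\<beta> \<in> cotangent_space \<A> x" "v \<in> tangent_space \<A> x"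
    have "(insert_at k \<alpha> \<omega>s, insert_at l v vs) \<in> tensor_args \<A> x p q"
      using tensor_args_insert[OF kl *(1,3)] args by blast
    then have "t ((insert_at k \<alpha> \<omega>s)[k := a *\<^sub>R \<alpha> + b *\<^sub>R \<beta>]) (insert_at l v vs) =
      a * t ((insert_at k \<alpha> \<omega>s)[k := \<alpha>]) (insert_at l v vs) +
      b * t ((insert_at k \<alpha> \<omega>s)[k := \<beta>]) (insert_at l v vs)"
      using t kl * unfolding tensor_space_def by blast
    then show "t (insert_at k (a *\<^sub>R \<alpha> + b *\<^sub>R \<beta>) \<omega>s) (insert_at l v vs) =
      a * t (insert_at k \<alpha> \<omega>s) (insert_at l v vs) + b * t (insert_at k \<beta> \<omega>s) (insert_at l v vs)"
      by (simp only: insert_at_update[OF len(1), symmetric])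
  }
  {
    assume *: "u \<in> tangent_space \<A> x" "v \<in> tangent_space \<A> x" "\<alpha> \<in> cotangent_space \<A> x"
    have "(insert_at k \<alpha> \<omega>s, insert_at l u vs) \<in> tensor_args \<A> x p q"
      using tensor_args_insert[OF kl *(3,1)] args by blast
    then have "t (insert_at k \<alpha> \<omega>s) ((insert_at l u vs)[l := a *\<^sub>R u + b *\<^sub>R v]) =
      a * t (insert_at k \<alpha> \<omega>s) ((insert_at l u vs)[l := u]) +
      b * t (insert_at k \<alpha> \<omega>s) ((insert_at l u vs)[l := v])"
      using t kl * unfolding tensor_space_def by blast
    then show "t (insert_at k \<alpha> \<omega>s) (insert_at l (a *\<^sub>R u + b *\<^sub>R v) vs) =
      a * t (insert_at k \<alpha> \<omega>s) (insert_at l u vs) + b * t (insert_at k \<alpha> \<omega>s) (insert_at l v vs)"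
      by (simp only: insert_at_update[OF len(2), symmetric])
  }
qed

lemma contraction_in_eq:
  assumes t: "t \<in> tensor_space \<A> x p q" and kl: "k < p" "l < q"
    and e: "basis_of e (tangent_space \<A> x)" and f: "basis_of f (tangent_space \<A> x)"
  shows "contraction_in e k l t = contraction_in f k l t"
proof (intro ext)
  fix \<omega>s vs
  note T = basis_of_subspace[OF e]
  note mem = basis_of_mem[OF e] basis_of_mem[OF f] dual_basis_cotangent[OF e] dual_basis_cotangent[OF f]
  show "contraction_in e k l t \<omega>s vs = contraction_in f k l t \<omega>s vs"
  proof (cases "(\<omega>s, vs) \<in> tensor_args \<A> x (p - 1) (q - 1)")
    case True
    define B where "B \<alpha> v = t (insert_at k \<alpha> \<omega>s) (insert_at l v vs)" for \<alpha> v
    note lin = tensor_slot_linear[OF t kl True T]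
    have "contraction_in f k l t \<omega>s vs = (\<Sum>i\<in>UNIV. B (dual_basis f i) (f i))"
      by (simp add: contraction_in_def B_def)
    also have "\<dots> = (\<Sum>i\<in>UNIV. \<Sum>j\<in>UNIV. dual_basis f i (e j) * B (dual_basis e j) (f i))"
    proof (rule sum.cong[OF refl])
      fix i
      have "B (dual_basis f i) (f i) = B (\<Sum>j\<in>UNIV. dual_basis f i (e j) *\<^sub>R dual_basis e j) (f i)"
        using cotangent_expansion[OF e mem(4)[of i]] by simp
      also have "\<dots> = (\<Sum>j\<in>UNIV. dual_basis f i (e j) * B (dual_basis e j) (f i))"
        unfolding B_def
        by (rule sum_of_linear_on[where g = "\<lambda>\<alpha>. t (insert_at k \<alpha> \<omega>s) (insert_at l (f i) vs)",
              OF subspace_cotangent]) (auto intro: lin(1) mem)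
      finally show "B (dual_basis f i) (f i) = (\<Sum>j\<in>UNIV. dual_basis f i (e j) * B (dual_basis e j) (f i))" .
    qed
    also have "\<dots> = (\<Sum>j\<in>UNIV. \<Sum>i\<in>UNIV. dual_basis f i (e j) * B (dual_basis e j) (f i))"
      by (rule sum.swap)
    also have "\<dots> = (\<Sum>j\<in>UNIV. B (dual_basis e j) (e j))"
    proof (rule sum.cong[OF refl])
      fix j
      have "B (dual_basis e j) (e j) = B (dual_basis e j) (\<Sum>i\<in>UNIV. dual_basis f i (e j) *\<^sub>R f i)"
        using basis_of_expansion[OF f mem(1)[of j]] by simp
      also have "\<dots> = (\<Sum>i\<in>UNIV. dual_basis f i (e j) * B (dual_basis e j) (f i))"
        unfolding B_def
        by (rule sum_of_linear_on[where g = "\<lambda>v. t (insert_at k (dual_basis e j) \<omega>s) (insert_at l v vs)",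
              OF T]) (auto intro: lin(2) mem)
      finally show "(\<Sum>i\<in>UNIV. dual_basis f i (e j) * B (dual_basis e j) (f i)) = B (dual_basis e j) (e j)" ..
    qed
    also have "\<dots> = contraction_in e k l t \<omega>s vs"
      by (simp add: contraction_in_def B_def)
    finally show ?thesis ..
  next
    case False
    show ?thesis
    proof -
      have "t (insert_at k \<alpha> \<omega>s) (insert_at l v vs) = 0"
        if "\<alpha> \<in> cotangent_space \<A> x" "v \<in> tangent_space \<A> x" for \<alpha> v
        using t False tensor_args_insert[OF kl that] unfolding tensor_space_def by blast
      then show ?thesis
        unfolding contraction_in_def by (simp add: mem)
    qed
  qed
qed

lemma contraction_any_basis:
  assumes "t \<in> tensor_space \<A> x p q" "k < p" "l < q" "basis_of e (tangent_space \<A> x)"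
  shows "contraction \<A> x k l t = contraction_in e k l t"
  unfolding contraction_def
  using contraction_in_eq[OF assms(1-3)] assms(4) by (metis (mono_tags, lifting) someI)

text \<open>The defining equation of the components has exactly one solution, and the bivector does not
  depend on the field of bases.\<close>

lemma tensor_args_1_0:
  "(\<omega>s, vs) \<in> tensor_args \<A> x (Suc 0) 0 \<longleftrightarrow> (\<exists>\<omega>. \<omega>s = [\<omega>] \<and> \<omega> \<in> cotangent_space \<A> x) \<and> vs = []"
  unfolding tensor_args_def by (auto simp: length_Suc_conv)

lemma vec_tensor_in_tensor_space: "vec_tensor \<A> x v \<in> tensor_space \<A> x 1 0"
  unfolding tensor_space_def vec_tensor_def
  by (auto simp: tensor_args_1_0 subspace_add[OF subspace_cotangent]
      subspace_scale[OF subspace_cotangent])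

lemma vec_tensor_expansion:
  assumes e: "basis_of e (tangent_space \<A> x)" and t: "t \<in> tensor_space \<A> x 1 0"
  shows "t = (\<Sum>i\<in>UNIV. t [dual_basis e i] [] *\<^sub>R vec_tensor \<A> x (e i))"
proof (intro ext)
  fix \<omega>s vs
  show "t \<omega>s vs = (\<Sum>i\<in>UNIV. t [dual_basis e i] [] *\<^sub>R vec_tensor \<A> x (e i)) \<omega>s vs"
  proof (cases "(\<omega>s, vs) \<in> tensor_args \<A> x 1 0")
    case True
    then obtain \<omega> where \<omega>: "\<omega> \<in> cotangent_space \<A> x" "\<omega>s = [\<omega>]" "vs = []"
      by (auto simp: tensor_args_1_0)
    have lin: "t [a *\<^sub>R \<alpha> + b *\<^sub>R \<beta>] [] = a * t [\<alpha>] [] + b * t [\<beta>] []"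
      if "\<alpha> \<in> cotangent_space \<A> x" "\<beta> \<in> cotangent_space \<A> x" for \<alpha> \<beta> a b
    proof -
      have "t ([\<omega>][0 := a *\<^sub>R \<alpha> + b *\<^sub>R \<beta>]) [] = a * t ([\<omega>][0 := \<alpha>]) [] + b * t ([\<omega>][0 := \<beta>]) []"
        using t True that unfolding \<omega>(2,3) tensor_space_def by blast
      then show ?thesis by simp
    qed
    have "t [\<omega>] [] = t [\<Sum>i\<in>UNIV. \<omega> (e i) *\<^sub>R dual_basis e i] []"
      using cotangent_expansion[OF e \<omega>(1)] by simp
    also have "\<dots> = (\<Sum>i\<in>UNIV. \<omega> (e i) * t [dual_basis e i] [])"
      by (rule sum_of_linear_on[where g = "\<lambda>\<alpha>. t [\<alpha>] []", OF subspace_cotangent])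
         (auto intro: lin dual_basis_cotangent[OF e])
    finally show ?thesis
      using True \<omega> by (simp add: sum_fun_apply vec_tensor_def mult.commute)
  next
    case False
    then show ?thesis
      using t unfolding tensor_space_def by (simp add: sum_fun_apply vec_tensor_def)
  qed
qed

lemma vec_tensor_sum_apply:
  assumes "\<omega> \<in> cotangent_space \<A> x"
  shows "(\<Sum>i\<in>I. a i *\<^sub>R vec_tensor \<A> x (v i)) [\<omega>] [] = (\<Sum>i\<in>I. a i * \<omega> (v i))"
  using assms by (simp add: sum_fun_apply vec_tensor_def tensor_args_1_0)

lemma vec_tensor_sum_unique:
  assumes e: "basis_of e (tangent_space \<A> x)"
    and "t = (\<Sum>i\<in>UNIV. a i *\<^sub>R vec_tensor \<A> x (e i))"
  shows "a i = t [dual_basis e i] []"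
  unfolding assms(2) vec_tensor_sum_apply[OF dual_basis_cotangent[OF e]]
  by (simp add: dual_basis_basis[OF e] if_distrib cong: if_cong)

lemma flat_linear_transport_type:
  assumes "flat_linear_transport M \<A> L" "x \<in> topspace M" "y \<in> topspace M"
    and "t \<in> tensor_space \<A> x p q"
  shows "L x y t \<in> tensor_space \<A> y p q"
proof -
  have "L x y ` tensor_space \<A> x p q \<subseteq> tensor_space \<A> y p q"
    using assms(1-3) unfolding flat_linear_transport_def by simp
  then show ?thesis
    using assms(4) by (rule image_subset_iff[THEN iffD1, THEN bspec])
qed

lemma flat_linear_transport_linear:
  assumes "flat_linear_transport M \<A> L" "x \<in> topspace M" "y \<in> topspace M"
    and "s \<in> tensor_space \<A> x p q" "t \<in> tensor_space \<A> x p q"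
  shows "L x y (a *\<^sub>R s + b *\<^sub>R t) = a *\<^sub>R L x y s + b *\<^sub>R L x y t"
proof -
  have "\<forall>p q. \<forall>s\<in>tensor_space \<A> x p q. \<forall>t\<in>tensor_space \<A> x p q. \<forall>a b.
      L x y (a *\<^sub>R s + b *\<^sub>R t) = a *\<^sub>R L x y s + b *\<^sub>R L x y t"
    using assms(1)[unfolded flat_linear_transport_def, THEN conjunct1, THEN bspec, OF assms(2),
        THEN bspec, OF assms(3)] by (elim conjE)
  then show ?thesis
    using assms(4,5) by blast
qed

lemma transport_components_unique:
  fixes h :: "real ^ 'n::finite ^ 'n"
  assumes "field_of_bases M \<A> E" "y \<in> topspace M"
    and h: "\<And>j. L x y (vec_tensor \<A> x (E x j)) = (\<Sum>i\<in>UNIV. (h $ i $ j) *\<^sub>R vec_tensor \<A> y (E y i))"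
  shows "transport_components \<A> L E y x = h"
  unfolding transport_components_def
proof (rule the_equality)
  have e: "basis_of (E y) (tangent_space \<A> y)"
    using assms unfolding field_of_bases_def by blast
  fix g :: "real ^ 'n ^ 'n"
  assume g: "\<forall>j. L x y (vec_tensor \<A> x (E x j)) = (\<Sum>i\<in>UNIV. (g $ i $ j) *\<^sub>R vec_tensor \<A> y (E y i))"
  have "g $ i $ j = h $ i $ j" for i j
  proof -
    have "g $ i $ j = L x y (vec_tensor \<A> x (E x j)) [dual_basis (E y) i] []"
      by (rule vec_tensor_sum_unique[OF e, where a = "\<lambda>i. g $ i $ j"]) (rule g[rule_format])
    moreover have "h $ i $ j = L x y (vec_tensor \<A> x (E x j)) [dual_basis (E y) i] []"
      by (rule vec_tensor_sum_unique[OF e, where a = "\<lambda>i. h $ i $ j"]) (rule h)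
    ultimately show ?thesis by (rule trans[OF _ sym])
  qed
  then show "g = h" by (simp add: vec_eq_iff)
qed (use h in blast)

lemma transport_components_eq:
  fixes \<A> :: "('m, 'n::finite) chart set"
  assumes "flat_linear_transport M \<A> L" "field_of_bases M \<A> E" "x \<in> topspace M" "y \<in> topspace M"
  shows "L x y (vec_tensor \<A> x (E x j)) =
    (\<Sum>i\<in>UNIV. (transport_components \<A> L E y x $ i $ j) *\<^sub>R vec_tensor \<A> y (E y i))"
proof -
  have b: "basis_of (E x) (tangent_space \<A> x)" "basis_of (E y) (tangent_space \<A> y)"
    using assms unfolding field_of_bases_def by blast+
  define h :: "real ^ 'n ^ 'n" where
    "h = (\<chi> i j. L x y (vec_tensor \<A> x (E x j)) [dual_basis (E y) i] [])"
  have "L x y (vec_tensor \<A> x (E x j)) \<in> tensor_space \<A> y 1 0" for j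
    by (rule flat_linear_transport_type[OF assms(1,3,4) vec_tensor_in_tensor_space])
  then have h: "L x y (vec_tensor \<A> x (E x j)) = (\<Sum>i\<in>UNIV. (h $ i $ j) *\<^sub>R vec_tensor \<A> y (E y i))" for j
    unfolding h_def vec_lambda_beta by (rule vec_tensor_expansion[OF b(2)])
  show ?thesis
    unfolding transport_components_unique[of M _ _ _ L, OF assms(2,4) h] by (rule h)
qed

lemma transport_bivector_eq:
  assumes L: "flat_linear_transport M \<A> L" and E: "field_of_bases M \<A> E"
    and xy: "x \<in> topspace M" "y \<in> topspace M"
    and \<omega>: "\<omega> \<in> cotangent_space \<A> y" and v: "v \<in> tangent_space \<A> x"
  shows "transport_bivector \<A> L E y x \<omega> v = L x y (vec_tensor \<A> x v) [\<omega>] []"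
proof -
  have b: "basis_of (E x) (tangent_space \<A> x)"
    using E xy unfolding field_of_bases_def by blast
  note T = basis_of_subspace[OF b]
  have lin: "L x y (a *\<^sub>R s + b *\<^sub>R t) = a *\<^sub>R L x y s + b *\<^sub>R L x y t"
    if "s \<in> tensor_space \<A> x 1 0" "t \<in> tensor_space \<A> x 1 0" for a b s t
    by (rule flat_linear_transport_linear[OF L xy that])
  have vt: "vec_tensor \<A> x (a *\<^sub>R u + b *\<^sub>R w) = a *\<^sub>R vec_tensor \<A> x u + b *\<^sub>R vec_tensor \<A> x w"
    if "u \<in> tangent_space \<A> x" "w \<in> tangent_space \<A> x" for a b u w
  proof (intro ext)
    have "\<omega> (a *\<^sub>R u + b *\<^sub>R w) = a * \<omega> u + b * \<omega> w" if "\<omega> \<in> cotangent_space \<A> x" for \<omega>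
      by (rule cotangent_lincomb[OF that T \<open>u \<in> _\<close> \<open>w \<in> _\<close>])
    then show "vec_tensor \<A> x (a *\<^sub>R u + b *\<^sub>R w) \<omega>s vs =
      (a *\<^sub>R vec_tensor \<A> x u + b *\<^sub>R vec_tensor \<A> x w) \<omega>s vs" for \<omega>s vs
      by (auto simp: vec_tensor_def tensor_args_1_0)
  qed
  define g where "g u = L x y (vec_tensor \<A> x u) [\<omega>] []" for u
  have "g v = g (\<Sum>j\<in>UNIV. dual_basis (E x) j v *\<^sub>R E x j)"
    using basis_of_expansion[OF b v] by simp
  also have "\<dots> = (\<Sum>j\<in>UNIV. dual_basis (E x) j v * g (E x j))"
    by (rule sum_of_linear_on[where g = g, OF T])
       (simp_all add: g_def vt lin[OF vec_tensor_in_tensor_space vec_tensor_in_tensor_space]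
         basis_of_mem[OF b])
  also have "\<dots> = (\<Sum>j\<in>UNIV. dual_basis (E x) j v *
      (\<Sum>i\<in>UNIV. transport_components \<A> L E y x $ i $ j * \<omega> (E y i)))"
    unfolding g_def transport_components_eq[OF L E xy] vec_tensor_sum_apply[OF \<omega>] ..
  also have "\<dots> = transport_bivector \<A> L E y x \<omega> v"
    unfolding transport_bivector_def sum_distrib_left
    by (subst sum.swap) (simp add: mult_ac)
  finally show ?thesis by (simp add: g_def)
qed

end

theory Submission
  imports Defs
begin

text \<open>In any field of bases \<open>G\<close> the components of the transport form a cocycle of matrices,
  \<open>H z y ** H y x = H z x\<close> and \<open>H x x = mat 1\<close> (lemmas \<open>transport_components_cocycle\<close>
  and \<open>transport_components_refl\<close>); in particular they are invertible. Passing to another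
  field of bases with transition matrices \<open>A x\<close> turns \<open>H y x\<close> into
  \<open>(A y)\<inverse> ** H y x ** A x\<close> (lemma \<open>transport_components_change\<close>).

  Fixing a base point \<open>z\<close> and taking \<open>A x = H x z\<close>, that is, spreading one basis at \<open>z\<close>
  over the manifold by the transport itself, makes the components \<open>mat 1\<close>. If the components in some
  field of bases are constant, then they equal \<open>H x x = mat 1\<close>. Finally, between two fields of
  bases one of which has components \<open>mat 1\<close>, the transformation law says that the components in the
  other one are \<open>mat 1\<close> exactly if \<open>A y = A x\<close> for all points.\<close>

section \<open>Matrices acting on families of vectors\<close>

text \<open>The action is on the right, with the columns of the matrix as coefficients, so that \<open>mat_act\<close>
  covers both changes of bases and, applied to families of tensors, the equation that defines the
  transport components.\<close>

definition mat_act :: "real ^ 'n ^ 'n \<Rightarrow> ('n::finite \<Rightarrow> 'v::real_vector) \<Rightarrow> 'n \<Rightarrow> 'v" where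
  "mat_act A e = (\<lambda>i. \<Sum>k\<in>UNIV. (A $ k $ i) *\<^sub>R e k)"

lemma mat_act_mat_1 [simp]: "mat_act (mat 1) e = e"
proof
  fix i
  have "mat_act (mat 1) e i = (\<Sum>k\<in>UNIV. if k = i then e k else 0)"
    unfolding mat_act_def by (rule sum.cong) (auto simp: mat_def)
  then show "mat_act (mat 1) e i = e i"
    by simp
qed

lemma mat_act_mult: "mat_act B (mat_act A e) = mat_act (A ** B) e"
proof
  fix i
  have "mat_act B (mat_act A e) i = (\<Sum>k\<in>UNIV. \<Sum>l\<in>UNIV. (A $ l $ k * B $ k $ i) *\<^sub>R e l)"
    by (simp add: mat_act_def scaleR_sum_right mult.commute)
  also have "\<dots> = mat_act (A ** B) e i"
    by (subst sum.swap) (simp add: mat_act_def matrix_matrix_mult_def scaleR_sum_left)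
  finally show "mat_act B (mat_act A e) i = mat_act (A ** B) e i" .
qed

lemma inj_independent_range_iff:
  fixes e :: "'n::finite \<Rightarrow> 'v::real_vector"
  shows "inj e \<and> independent (range e) \<longleftrightarrow>
    (\<forall>c. (\<Sum>i\<in>UNIV. c i *\<^sub>R e i) = 0 \<longrightarrow> (\<forall>i. c i = 0))"
proof (intro iffI conjI allI impI)
  fix c i
  assume e: "inj e \<and> independent (range e)" and 0: "(\<Sum>i\<in>UNIV. c i *\<^sub>R e i) = 0"
  have "(\<Sum>v\<in>range e. c (inv e v) *\<^sub>R v) = 0"
    using e 0 by (simp add: sum.reindex)
  moreover have "\<forall>u. (\<Sum>v\<in>range e. u v *\<^sub>R v) = 0 \<longrightarrow> (\<forall>v\<in>range e. u v = 0)"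
    using e dependent_finite[of "range e"] by auto
  ultimately have "c (inv e (e i)) = 0"
    by (elim allE[where x = "\<lambda>v. c (inv e v)"]) simp
  then show "c i = 0"
    using e by simp
next
  assume c: "\<forall>c. (\<Sum>i\<in>UNIV. c i *\<^sub>R e i) = 0 \<longrightarrow> (\<forall>i. c i = 0)"
  show inj: "inj e"
  proof (rule injI, rule ccontr)
    fix i j
    assume ij: "e i = e j" "i \<noteq> j"
    have "(\<Sum>k\<in>UNIV. (of_bool (k = i) - of_bool (k = j)) *\<^sub>R e k) =
      (\<Sum>k\<in>UNIV. if k = i then e k else 0) - (\<Sum>k\<in>UNIV. if k = j then e k else 0)"
      unfolding sum_subtractf[symmetric] by (rule sum.cong) auto
    also have "\<dots> = 0"
      using ij by simp
    finally show False
      using c[rule_format, of "\<lambda>k. of_bool (k = i) - of_bool (k = j)" i] ij by simp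
  qed
  show "independent (range e)"
  proof
    assume "dependent (range e)"
    then obtain u i where "u (e i) \<noteq> 0" "(\<Sum>v\<in>range e. u v *\<^sub>R v) = 0"
      using dependent_finite[of "range e"] by auto
    then show False
      using c[rule_format, of "\<lambda>i. u (e i)" i] inj by (simp add: sum.reindex)
  qed
qed

lemma basis_of_coeff_zero:
  assumes "basis_of e V" "(\<Sum>i\<in>UNIV. c i *\<^sub>R e i) = 0"
  shows "c i = 0"
proof -
  have "\<forall>c. (\<Sum>i\<in>UNIV. c i *\<^sub>R e i) = 0 \<longrightarrow> (\<forall>i. c i = 0)"
    using assms(1) unfolding basis_of_def inj_independent_range_iff[symmetric] by blast
  with assms(2) show ?thesis
    by blast
qed

lemma mat_act_cancel:
  assumes "basis_of e V" "mat_act A e = mat_act B e"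
  shows "A = B"
proof -
  have "A $ k $ i - B $ k $ i = 0" for i k
  proof -
    have "(\<Sum>k\<in>UNIV. (A $ k $ i - B $ k $ i) *\<^sub>R e k) = 0"
      using fun_cong[OF assms(2), of i]
      by (simp add: mat_act_def scaleR_diff_left sum_subtractf)
    then show ?thesis
      by (rule basis_of_coeff_zero[OF assms(1), where c = "\<lambda>k. A $ k $ i - B $ k $ i"])
  qed
  then show ?thesis
    by (simp add: vec_eq_iff)
qed

lemma mat_act_in_span: "mat_act A e i \<in> span (range e)"
  unfolding mat_act_def by (intro span_sum span_scale span_base) simp

lemma basis_of_mat_act:
  assumes e: "basis_of e V" and "invertible A"
  shows "basis_of (mat_act A e) V"
proof -
  obtain B where B: "A ** B = mat 1" "B ** A = mat 1"
    using assms(2) unfolding invertible_def by blast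
  then have e_eq: "e = mat_act B (mat_act A e)"
    by (simp add: mat_act_mult)
  have "span (range (mat_act A e)) = span (range e)"
  proof (rule span_eq[THEN iffD2], rule conjI)
    show "range (mat_act A e) \<subseteq> span (range e)"
      using mat_act_in_span by blast
    show "range e \<subseteq> span (range (mat_act A e))"
      using mat_act_in_span[of B "mat_act A e"] unfolding e_eq[symmetric] by blast
  qed
  moreover have "c i = 0" if 0: "(\<Sum>i\<in>UNIV. c i *\<^sub>R mat_act A e i) = 0" for c i
  proof -
    \<comment> \<open>The coefficients of this combination with respect to \<open>e\<close> are \<open>A *v c\<close>.\<close>
    have "(\<Sum>i\<in>UNIV. c i *\<^sub>R mat_act A e i) =
        (\<Sum>i\<in>UNIV. \<Sum>k\<in>UNIV. (A $ k $ i * c i) *\<^sub>R e k)"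
      by (simp add: mat_act_def scaleR_sum_right mult.commute)
    also have "\<dots> = (\<Sum>k\<in>UNIV. ((A *v vec_lambda c) $ k) *\<^sub>R e k)"
      by (subst sum.swap) (simp add: matrix_vector_mult_def scaleR_sum_left)
    finally have "(\<Sum>k\<in>UNIV. ((A *v vec_lambda c) $ k) *\<^sub>R e k) = 0"
      using 0 by simp
    then have "(A *v vec_lambda c) $ k = 0" for k
      by (rule basis_of_coeff_zero[OF e, where c = "\<lambda>k. (A *v vec_lambda c) $ k"])
    then have "A *v vec_lambda c = 0"
      by (simp add: vec_eq_iff)
    then have "B *v (A *v vec_lambda c) = 0"
      by simp
    then have "vec_lambda c = 0"
      using B by (simp add: matrix_vector_mul_assoc)
    then show ?thesis
      by (simp add: vec_eq_iff)
  qed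
  ultimately show ?thesis
    using e inj_independent_range_iff[of "mat_act A e"] unfolding basis_of_def by blast
qed

lemma bases_related_by_invertible:
  fixes e f :: "'n::finite \<Rightarrow> ('m, 'n) tvec"
  assumes e: "basis_of e V" and f: "basis_of f V"
  obtains A where "invertible A" "f = mat_act A e"
proof -
  define A :: "real ^ 'n ^ 'n" where "A = (\<chi> k i. dual_basis e k (f i))"
  define B :: "real ^ 'n ^ 'n" where "B = (\<chi> k i. dual_basis f k (e i))"
  have A: "f = mat_act A e"
    using basis_of_expansion[OF e basis_of_mem[OF f]] by (simp add: A_def mat_act_def fun_eq_iff)
  have B: "e = mat_act B f"
    using basis_of_expansion[OF f basis_of_mem[OF e]] by (simp add: B_def mat_act_def fun_eq_iff)
  have "mat_act (A ** B) e = mat_act (mat 1) e"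
    using A B by (simp flip: mat_act_mult)
  then have "A ** B = mat 1"
    by (rule mat_act_cancel[OF e])
  moreover have "mat_act (B ** A) f = mat_act (mat 1) f"
    using A B by (simp flip: mat_act_mult)
  then have "B ** A = mat 1"
    by (rule mat_act_cancel[OF f])
  ultimately show thesis
    using that A unfolding invertible_def by blast
qed


section \<open>Matrices commute with the transport of vectors\<close>

lemma vec_tensor_mat_act:
  assumes e: "basis_of e (tangent_space \<A> x)"
  shows "(\<lambda>j. vec_tensor \<A> x (mat_act A e j)) = mat_act A (\<lambda>i. vec_tensor \<A> x (e i))"
proof (intro ext)
  fix j \<omega>s vs
  note T = basis_of_subspace[OF e]
  have cov: "\<omega> (mat_act A e j) = (\<Sum>i\<in>UNIV. A $ i $ j * \<omega> (e i))" if "\<omega> \<in> cotangent_space \<A> x" for \<omega>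
    unfolding mat_act_def
    by (rule sum_of_linear_on[where g = \<omega>, OF T])
       (auto intro: basis_of_mem[OF e] cotangent_lincomb[OF that T])
  have "mat_act A (\<lambda>i. vec_tensor \<A> x (e i)) j \<omega>s vs =
      (\<Sum>i\<in>UNIV. A $ i $ j * vec_tensor \<A> x (e i) \<omega>s vs)"
    by (simp add: mat_act_def sum_fun_apply)
  moreover have "vec_tensor \<A> x (mat_act A e j) \<omega>s vs =
      (\<Sum>i\<in>UNIV. A $ i $ j * vec_tensor \<A> x (e i) \<omega>s vs)"
  proof (cases "(\<omega>s, vs) \<in> tensor_args \<A> x 1 0")
    case True
    then show ?thesis
      using cov by (auto simp: vec_tensor_def tensor_args_1_0)
  next
    case False
    then show ?thesis
      by (simp only: vec_tensor_def if_False mult_zero_right sum.neutral_const)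
  qed
  ultimately show "vec_tensor \<A> x (mat_act A e j) \<omega>s vs =
      mat_act A (\<lambda>i. vec_tensor \<A> x (e i)) j \<omega>s vs"
    by simp
qed

lemma subspace_tensor_space: "subspace (tensor_space \<A> x p q)"
proof (rule subspaceI)
  let ?C = "cotangent_space \<A> x" and ?T = "tangent_space \<A> x" and ?args = "tensor_args \<A> x p q"
  show "0 \<in> tensor_space \<A> x p q"
    unfolding tensor_space_def by simp
  fix s t and c :: real
  assume s: "s \<in> tensor_space \<A> x p q" and t: "t \<in> tensor_space \<A> x p q"
  have zero: "r \<omega>s vs = 0" if "r \<in> tensor_space \<A> x p q" "(\<omega>s, vs) \<notin> ?args" for r \<omega>s vs
    using that unfolding tensor_space_def by blast
  have lin1: "r (\<omega>s[k := a *\<^sub>R \<alpha> + b *\<^sub>R \<beta>]) vs = a * r (\<omega>s[k := \<alpha>]) vs + b * r (\<omega>s[k := \<beta>]) vs"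
    if "r \<in> tensor_space \<A> x p q" "(\<omega>s, vs) \<in> ?args" "k < p" "\<alpha> \<in> ?C" "\<beta> \<in> ?C"
    for r \<omega>s vs k \<alpha> \<beta> a b
    using that unfolding tensor_space_def by blast
  have lin2: "r \<omega>s (vs[l := a *\<^sub>R u + b *\<^sub>R v]) = a * r \<omega>s (vs[l := u]) + b * r \<omega>s (vs[l := v])"
    if "r \<in> tensor_space \<A> x p q" "(\<omega>s, vs) \<in> ?args" "l < q" "u \<in> ?T" "v \<in> ?T"
    for r \<omega>s vs l u v a b
    using that unfolding tensor_space_def by blast
  show "s + t \<in> tensor_space \<A> x p q"
    unfolding tensor_space_def
    by (safe; simp add: zero[OF s] zero[OF t] lin1[OF s] lin1[OF t] lin2[OF s] lin2[OF t]
        algebra_simps)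
  show "c *\<^sub>R s \<in> tensor_space \<A> x p q"
    unfolding tensor_space_def
    by (safe; simp add: zero[OF s] lin1[OF s] lin2[OF s] algebra_simps)
qed

lemma flat_linear_transport_sum:
  assumes L: "flat_linear_transport M \<A> L" "x \<in> topspace M" "y \<in> topspace M"
    and "finite I" and t: "\<And>i. i \<in> I \<Longrightarrow> t i \<in> tensor_space \<A> x p q"
  shows "L x y (\<Sum>i\<in>I. a i *\<^sub>R t i) = (\<Sum>i\<in>I. a i *\<^sub>R L x y (t i))"
  using assms(4) t
proof (induction I)
  case empty
  note 0 = subspace_0[OF subspace_tensor_space[of \<A> x p q]]
  from flat_linear_transport_linear[OF L 0 0, of 0 0] show ?case
    by (simp only: sum.empty scaleR_zero_left add_0)
next
  case (insert i I)
  have "(\<Sum>i\<in>I. a i *\<^sub>R t i) \<in> tensor_space \<A> x p q"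
    using insert.prems by (intro subspace_sum subspace_scale subspace_tensor_space) simp
  from flat_linear_transport_linear[OF L insert.prems[OF insertI1] this, of "a i" 1]
  have "L x y (a i *\<^sub>R t i + (\<Sum>i\<in>I. a i *\<^sub>R t i)) =
      a i *\<^sub>R L x y (t i) + L x y (\<Sum>i\<in>I. a i *\<^sub>R t i)"
    by (simp only: scaleR_one)
  also have "L x y (\<Sum>i\<in>I. a i *\<^sub>R t i) = (\<Sum>i\<in>I. a i *\<^sub>R L x y (t i))"
    using insert.IH insert.prems by blast
  finally show ?case
    by (simp only: sum.insert[OF insert.hyps])
qed

lemma flat_linear_transport_mat_act:
  assumes "flat_linear_transport M \<A> L" "x \<in> topspace M" "y \<in> topspace M"
    and "\<And>i. t i \<in> tensor_space \<A> x p q"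
  shows "(\<lambda>j. L x y (mat_act A t j)) = mat_act A (\<lambda>i. L x y (t i))"
  unfolding mat_act_def
  by (rule ext, rule flat_linear_transport_sum[OF assms(1-3) finite assms(4)])

text \<open>The matrix of components is determined by its action on vectors regarded as tensors, since
  \<^const>\<open>vec_tensor\<close> preserves linear independence.\<close>

lemma mat_act_vec_tensor_cancel:
  fixes e :: "'n::finite \<Rightarrow> ('m, 'n) tvec"
  assumes e: "basis_of e (tangent_space \<A> x)"
    and eq: "mat_act A (\<lambda>i. vec_tensor \<A> x (e i)) = mat_act B (\<lambda>i. vec_tensor \<A> x (e i))"
  shows "A = B"
proof -
  have entry: "C $ i $ j = mat_act C (\<lambda>i. vec_tensor \<A> x (e i)) j [dual_basis e i] []"
    for C :: "real ^ 'n ^ 'n" and i j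
    by (rule vec_tensor_sum_unique[OF e, where a = "\<lambda>i. C $ i $ j"]) (simp only: mat_act_def)
  have "A $ i $ j = B $ i $ j" for i j
    unfolding entry eq ..
  then show ?thesis
    by (simp add: vec_eq_iff)
qed


section \<open>The cocycle of transport components and its transformation law\<close>

lemma transport_field:
  assumes "flat_linear_transport M \<A> L" "field_of_bases M \<A> E" "x \<in> topspace M" "y \<in> topspace M"
  shows "(\<lambda>j. L x y (vec_tensor \<A> x (E x j))) =
    mat_act (transport_components \<A> L E y x) (\<lambda>i. vec_tensor \<A> y (E y i))"
  unfolding mat_act_def by (rule ext) (rule transport_components_eq[OF assms])

lemma transport_components_refl:
  assumes L: "flat_linear_transport M \<A> L" and E: "field_of_bases M \<A> E" and x: "x \<in> topspace M"
  shows "transport_components \<A> L E x x = mat 1"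
proof (rule mat_act_vec_tensor_cancel)
  show "basis_of (E x) (tangent_space \<A> x)"
    using E x unfolding field_of_bases_def by blast
  have "L x x (vec_tensor \<A> x v) = vec_tensor \<A> x v" for v
    using L[unfolded flat_linear_transport_def, THEN conjunct2, THEN bspec, OF x]
      vec_tensor_in_tensor_space[of \<A> x v] by blast
  then show "mat_act (transport_components \<A> L E x x) (\<lambda>i. vec_tensor \<A> x (E x i)) =
      mat_act (mat 1) (\<lambda>i. vec_tensor \<A> x (E x i))"
    unfolding transport_field[OF L E x x, symmetric] by simp
qed

lemma flat_linear_transport_comp:
  assumes "flat_linear_transport M \<A> L" "x \<in> topspace M" "y \<in> topspace M" "z \<in> topspace M"
    and "t \<in> tensor_space \<A> x p q"
  shows "L y z (L x y t) = L x z t"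
proof -
  have "\<forall>z\<in>topspace M. \<forall>p q. \<forall>t\<in>tensor_space \<A> x p q. L y z (L x y t) = L x z t"
    using assms(1)[unfolded flat_linear_transport_def, THEN conjunct1, THEN bspec, OF assms(2),
        THEN bspec, OF assms(3)] by (elim conjE)
  then show ?thesis
    using assms(4,5) by blast
qed

lemma transport_components_cocycle:
  assumes L: "flat_linear_transport M \<A> L" and E: "field_of_bases M \<A> E"
    and xyz: "x \<in> topspace M" "y \<in> topspace M" "z \<in> topspace M"
  shows "transport_components \<A> L E z y ** transport_components \<A> L E y x =
    transport_components \<A> L E z x"
proof (rule mat_act_vec_tensor_cancel)
  show "basis_of (E z) (tangent_space \<A> z)"
    using E xyz unfolding field_of_bases_def by blast
  let ?H = "transport_components \<A> L E" and ?v = "\<lambda>u i. vec_tensor \<A> u (E u i)"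
  have "mat_act (?H z y ** ?H y x) (?v z) = mat_act (?H y x) (\<lambda>i. L y z (?v y i))"
    unfolding transport_field[OF L E xyz(2,3)] mat_act_mult ..
  also have "\<dots> = (\<lambda>j. L y z (mat_act (?H y x) (?v y) j))"
    by (rule flat_linear_transport_mat_act[OF L xyz(2,3) vec_tensor_in_tensor_space, symmetric])
  also have "\<dots> = (\<lambda>j. L y z (L x y (?v x j)))"
    unfolding transport_field[OF L E xyz(1,2), symmetric] ..
  also have "\<dots> = (\<lambda>j. L x z (?v x j))"
    unfolding flat_linear_transport_comp[OF L xyz vec_tensor_in_tensor_space] ..
  also have "\<dots> = mat_act (?H z x) (?v z)"
    by (rule transport_field[OF L E xyz(1,3)])
  finally show "mat_act (?H z y ** ?H y x) (?v z) = mat_act (?H z x) (?v z)" .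
qed

lemma transport_components_invertible:
  assumes "flat_linear_transport M \<A> L" "field_of_bases M \<A> E" "x \<in> topspace M" "y \<in> topspace M"
  shows "invertible (transport_components \<A> L E y x)"
  unfolding invertible_def
  using assms transport_components_cocycle[OF assms(1,2)] transport_components_refl[OF assms(1,2)]
  by (intro exI[of _ "transport_components \<A> L E x y"]) simp

text \<open>Both sides express the transport of \<open>E x j\<close> to \<open>y\<close> in the basis \<open>G y\<close>: on the left by
  transporting first, on the right by expanding in \<open>G x\<close> first.\<close>

lemma transport_components_change:
  assumes L: "flat_linear_transport M \<A> L"
    and G: "field_of_bases M \<A> G" and E: "field_of_bases M \<A> E"
    and xy: "x \<in> topspace M" "y \<in> topspace M"
    and A: "E x = mat_act A (G x)" and B: "E y = mat_act B (G y)"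
  shows "B ** transport_components \<A> L E y x = transport_components \<A> L G y x ** A"
proof (rule mat_act_vec_tensor_cancel)
  have b: "basis_of (G x) (tangent_space \<A> x)" "basis_of (G y) (tangent_space \<A> y)"
    using G xy unfolding field_of_bases_def by blast+
  then show "basis_of (G y) (tangent_space \<A> y)"
    by simp
  let ?HE = "transport_components \<A> L E y x" and ?HG = "transport_components \<A> L G y x"
  let ?g = "\<lambda>u i. vec_tensor \<A> u (G u i)"
  have "mat_act (B ** ?HE) (?g y) = mat_act ?HE (\<lambda>i. vec_tensor \<A> y (E y i))"
    unfolding B vec_tensor_mat_act[OF b(2)] mat_act_mult ..
  also have "\<dots> = (\<lambda>j. L x y (vec_tensor \<A> x (E x j)))"
    by (rule transport_field[OF L E xy, symmetric])
  also have "\<dots> = (\<lambda>j. L x y (mat_act A (?g x) j))"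
    unfolding A vec_tensor_mat_act[OF b(1), symmetric] ..
  also have "\<dots> = mat_act A (\<lambda>i. L x y (?g x i))"
    by (rule flat_linear_transport_mat_act[OF L xy vec_tensor_in_tensor_space])
  also have "\<dots> = mat_act (?HG ** A) (?g y)"
    unfolding transport_field[OF L G xy] mat_act_mult ..
  finally show "mat_act (B ** ?HE) (?g y) = mat_act (?HG ** A) (?g y)" .
qed


section \<open>Fields of bases adapted to a flat linear transport\<close>

lemma invertible_mult_eq_self:
  fixes A B :: "real ^ 'n::finite ^ 'n"
  assumes "invertible A" "A ** B = A"
  shows "B = mat 1"
proof -
  obtain C where "C ** A = mat 1"
    using assms(1) unfolding invertible_def by blast
  then show ?thesis
    using assms(2) by (metis matrix_mul_assoc matrix_mul_lid)
qed

lemma adapted_field_of_bases_exists: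
  assumes M: "differentiable_manifold M \<A>" and L: "flat_linear_transport M \<A> L"
  obtains E where "field_of_bases M \<A> E"
    "\<And>x y. x \<in> topspace M \<Longrightarrow> y \<in> topspace M \<Longrightarrow> transport_components \<A> L E x y = mat 1"
proof -
  from tangent_space_basis_exists[OF M] obtain G where G: "field_of_bases M \<A> G"
    unfolding field_of_bases_def by metis
  \<comment> \<open>Nothing is claimed when there are no points, so the choice of the base point is harmless.\<close>
  define z where "z = (SOME u. u \<in> topspace M)"
  have z: "z \<in> topspace M" if "x \<in> topspace M" for x
    unfolding z_def using that by (rule someI)
  let ?H = "transport_components \<A> L G"
  \<comment> \<open>\<open>E x\<close> is the basis \<open>G z\<close> transported from \<open>z\<close> to \<open>x\<close>.\<close>
  define E where "E x = mat_act (?H x z) (G x)" for x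
  have E: "field_of_bases M \<A> E"
    using G z transport_components_invertible[OF L G] unfolding field_of_bases_def E_def
    by (blast intro: basis_of_mat_act)
  have "transport_components \<A> L E x y = mat 1" if xy: "x \<in> topspace M" "y \<in> topspace M" for x y
  proof (rule invertible_mult_eq_self)
    show "invertible (?H x z)"
      by (rule transport_components_invertible[OF L G z[OF xy(1)] xy(1)])
    have "?H x z ** transport_components \<A> L E x y = ?H x y ** ?H y z"
      by (rule transport_components_change[OF L G E xy(2,1)]) (simp_all add: E_def)
    also have "\<dots> = ?H x z"
      by (rule transport_components_cocycle[OF L G z[OF xy(1)] xy(2,1)])
    finally show "?H x z ** transport_components \<A> L E x y = ?H x z" .
  qed
  with E show thesis
    by (rule that)
qed

theorem proposition4p1:
  fixes M :: "'m topology"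
    and \<A> :: "('m, 'n::finite) chart set"
    and L :: "'m \<Rightarrow> 'm \<Rightarrow> ('m, 'n) tensor \<Rightarrow> ('m, 'n) tensor"
  assumes "differentiable_manifold M \<A>"
    and "flat_linear_transport M \<A> L"
  shows "\<exists>E'. field_of_bases M \<A> E' \<and>
      (\<forall>x\<in>topspace M. \<forall>y\<in>topspace M. transport_components \<A> L E' x y = mat 1) \<and>
      (\<forall>E. field_of_bases M \<A> E \<and>
           (\<exists>C. \<forall>x\<in>topspace M. \<forall>y\<in>topspace M. transport_components \<A> L E x y = C) \<longrightarrow>
         (\<forall>x\<in>topspace M. \<forall>y\<in>topspace M. transport_components \<A> L E x y = mat 1) \<and>
         (\<exists>A :: real ^ 'n ^ 'n. invertible A \<and>
            (\<forall>x\<in>topspace M. \<forall>i. E x i = (\<Sum>k\<in>UNIV. (A $ k $ i) *\<^sub>R E' x k)))) \<and>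
      (\<forall>E (A :: real ^ 'n ^ 'n). invertible A \<and>
           (\<forall>x\<in>topspace M. \<forall>i. E x i = (\<Sum>k\<in>UNIV. (A $ k $ i) *\<^sub>R E' x k)) \<longrightarrow>
         field_of_bases M \<A> E \<and>
         (\<forall>x\<in>topspace M. \<forall>y\<in>topspace M. transport_components \<A> L E x y = mat 1))"
proof -
  note L = assms(2)
  obtain E' where E': "field_of_bases M \<A> E'"
    and one: "\<And>x y. x \<in> topspace M \<Longrightarrow> y \<in> topspace M \<Longrightarrow> transport_components \<A> L E' x y = mat 1"
    using adapted_field_of_bases_exists[OF assms] by blast
  have const: "(\<forall>x\<in>topspace M. \<forall>y\<in>topspace M. transport_components \<A> L E x y = mat 1) \<and>
      (\<exists>A :: real ^ 'n ^ 'n. invertible A \<and> (\<forall>x\<in>topspace M. E x = mat_act A (E' x)))"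
    if E: "field_of_bases M \<A> E"
      and C: "\<forall>x\<in>topspace M. \<forall>y\<in>topspace M. transport_components \<A> L E x y = C" for E C
  proof
    have "C = mat 1" if "x \<in> topspace M" for x
      using C that transport_components_refl[OF L E that] by simp
    with C show oneE: "\<forall>x\<in>topspace M. \<forall>y\<in>topspace M. transport_components \<A> L E x y = mat 1"
      by blast
    show "\<exists>A :: real ^ 'n ^ 'n. invertible A \<and> (\<forall>x\<in>topspace M. E x = mat_act A (E' x))"
    proof (cases "topspace M = {}")
      case True
      then show ?thesis
        using invertible_def[of "mat 1 :: real ^ 'n ^ 'n"] by (metis empty_iff matrix_mul_lid)
    next
      case False
      then obtain z where z: "z \<in> topspace M"
        by blast
      have ex: "\<exists>A. invertible A \<and> E x = mat_act A (E' x)" if "x \<in> topspace M" for x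
        using E E' that unfolding field_of_bases_def by (metis bases_related_by_invertible)
      then obtain A where A: "invertible A" "E z = mat_act A (E' z)"
        using z by blast
      have "E x = mat_act A (E' x)" if x: "x \<in> topspace M" for x
      proof -
        obtain B where B: "E x = mat_act B (E' x)"
          using ex[OF x] by blast
        \<comment> \<open>Both component matrices are \<open>mat 1\<close> in the transformation law between \<open>z\<close> and \<open>x\<close>.\<close>
        have "B = A"
          using transport_components_change[OF L E' E z x A(2) B] one x z oneE by simp
        with B show ?thesis
          by simp
      qed
      with A(1) show ?thesis
        by blast
    qed
  qed
  have converse: "field_of_bases M \<A> E \<and>
      (\<forall>x\<in>topspace M. \<forall>y\<in>topspace M. transport_components \<A> L E x y = mat 1)"
    if A: "invertible A" and EA: "\<And>x. x \<in> topspace M \<Longrightarrow> E x = mat_act A (E' x)"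
    for E and A :: "real ^ 'n ^ 'n"
  proof
    show E: "field_of_bases M \<A> E"
      using E' basis_of_mat_act[OF _ A] EA unfolding field_of_bases_def by (metis (no_types))
    show "\<forall>x\<in>topspace M. \<forall>y\<in>topspace M. transport_components \<A> L E x y = mat 1"
    proof (intro ballI)
      fix x y
      assume xy: "x \<in> topspace M" "y \<in> topspace M"
      have "A ** transport_components \<A> L E x y = A"
        using transport_components_change[OF L E' E xy(2,1) EA[OF xy(2)] EA[OF xy(1)]] one xy
        by simp
      with A show "transport_components \<A> L E x y = mat 1"
        by (rule invertible_mult_eq_self)
    qed
  qed
  show ?thesis
  proof (intro exI[of _ E'] conjI allI impI)
    show "field_of_bases M \<A> E'"
      by (rule E')
    show "\<forall>x\<in>topspace M. \<forall>y\<in>topspace M. transport_components \<A> L E' x y = mat 1"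
      using one by blast
  next
    fix E
    assume "field_of_bases M \<A> E \<and>
      (\<exists>C. \<forall>x\<in>topspace M. \<forall>y\<in>topspace M. transport_components \<A> L E x y = C)"
    then obtain C where E: "field_of_bases M \<A> E"
      and C: "\<forall>x\<in>topspace M. \<forall>y\<in>topspace M. transport_components \<A> L E x y = C"
      by blast
    note * = const[OF E C]
    show "\<forall>x\<in>topspace M. \<forall>y\<in>topspace M. transport_components \<A> L E x y = mat 1"
      using * by (rule conjunct1)
    from * obtain A :: "real ^ 'n ^ 'n" where "invertible A"
      and EA: "\<forall>x\<in>topspace M. E x = mat_act A (E' x)"
      by blast
    moreover have "E x i = (\<Sum>k\<in>UNIV. (A $ k $ i) *\<^sub>R E' x k)" if "x \<in> topspace M" for x i
      unfolding EA[rule_format, OF that] mat_act_def ..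
    ultimately show "\<exists>A :: real ^ 'n ^ 'n. invertible A \<and>
        (\<forall>x\<in>topspace M. \<forall>i. E x i = (\<Sum>k\<in>UNIV. (A $ k $ i) *\<^sub>R E' x k))"
      by blast
  next
    fix E and A :: "real ^ 'n ^ 'n"
    assume *: "invertible A \<and>
      (\<forall>x\<in>topspace M. \<forall>i. E x i = (\<Sum>k\<in>UNIV. (A $ k $ i) *\<^sub>R E' x k))"
    then have EA: "E x = mat_act A (E' x)" if "x \<in> topspace M" for x
      using that unfolding mat_act_def by blast
    note ** = converse[OF conjunct1[OF *] EA]
    show "field_of_bases M \<A> E"
      using ** by (rule conjunct1)
    show "\<forall>x\<in>topspace M. \<forall>y\<in>topspace M. transport_components \<A> L E x y = mat 1"
      using ** by (rule conjunct2)
  qed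
qed

end
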